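(* Let $(d_1,d_2,d_3)$ be an $\varepsilon$-hyper relative differential operator on a Lie algebra $\mathfrak g$ with respect to a representation $(V;\rho)$, with $\varepsilon=(\varepsilon_1,\varepsilon_2,\varepsilon_3)$. For every $i\in\mathbb Z_3$, the operator $N_i:=d_{i-1}^{-1}\circ d_{i+1}:\mathfrak g\to\mathfrak g$ is a Nijenhuis operator on $\mathfrak g$. In particular, if $\varepsilon_i=-1$ then $N_i$ is a complex structure on $\mathfrak g$, while if $\varepsilon_i=1$ then $N_i$ is a para-complex structure on $\mathfrak g$.
   Context: Everything is over a ground field $\mathbb K$. Let $\mathfrak g$ be a Lie algebra and $\rho:\mathfrak g\to\mathfrak{gl}(V)$ a representation, denoted $(V;\rho)$. A relative differential operator (with respect to $(V;\rho)$) is a linear map $d:\mathfrak g\to V$ with $d[x,y]=\rho(x)d(y)-\rho(y)d(x)$ for all $x,y\in\mathfrak g$. Indices are in $\mathbb Z_3=\{1,2,3\}$ (mod 3). Let $d_1,d_2,d_3:\mathfrak g\to V$ be invertible relative differential operators with respect to $(V;\rho)$; set $T_i:=d_i^{-1}$ and $N_i:=T_{i-1}\circ d_{i+1}$. If $N_i^2=\varepsilon_i\,\mathrm{Id}_{\mathfrak g}$ with $\varepsilon_i\in\{1,-1\}$ for $i=1,2,3$, the triple $(d_1,d_2,d_3)$ is called an $\varepsilon=(\varepsilon_1,\varepsilon_2,\varepsilon_3)$-hyper relative differential operator. A Nijenhuis operator on $\mathfrak g$ is a linear map $N:\mathfrak g\to\mathfrak g$ with $[N(x),N(y)]=N\big([N(x),y]+[x,N(y)]-N[x,y]\big)$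 for all $x,y\in\mathfrak g$. A complex structure is a Nijenhuis operator with $N^2=-\mathrm{Id}_{\mathfrak g}$; a para-complex structure is a Nijenhuis operator with $N^2=\mathrm{Id}_{\mathfrak g}$. *)

theory Defs
  imports Complex_Main "HOL-Library.Numeral_Type"
begin

locale lie_algebra = vector_space scale
  for scale :: "'k::field \<Rightarrow> 'g::ab_group_add \<Rightarrow> 'g" +
  fixes bracket :: "'g \<Rightarrow> 'g \<Rightarrow> 'g"
  assumes bracket_linear_left: "Vector_Spaces.linear scale scale (\<lambda>x. bracket x y)"
    and bracket_linear_right: "Vector_Spaces.linear scale scale (\<lambda>y. bracket x y)"
    and bracket_self: "bracket x x = 0"
    and jacobi: "bracket x (bracket y z) + bracket y (bracket z x) + bracket z (bracket x y) = 0"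

locale lie_representation =
  lie_algebra scaleg bracket + V: vector_space scalev
  for scaleg :: "'k::field \<Rightarrow> 'g::ab_group_add \<Rightarrow> 'g"
    and bracket :: "'g \<Rightarrow> 'g \<Rightarrow> 'g"
    and scalev :: "'k \<Rightarrow> 'v::ab_group_add \<Rightarrow> 'v" +
  fixes \<rho> :: "'g \<Rightarrow> 'v \<Rightarrow> 'v"
  assumes rho_endomorphism: "Vector_Spaces.linear scalev scalev (\<rho> x)"
    and rho_linear: "Vector_Spaces.linear scaleg scalev (\<lambda>x. \<rho> x v)"
    and rho_bracket: "\<rho> (bracket x y) v = \<rho> x (\<rho> y v) - \<rho> y (\<rho> x v)"

definition relative_differential_operator ::
  "('k::field \<Rightarrow> 'g::ab_group_add \<Rightarrow> 'g) \<Rightarrow> ('g \<Rightarrow> 'g \<Rightarrow> 'g) \<Rightarrow>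
   ('k \<Rightarrow> 'v::ab_group_add \<Rightarrow> 'v) \<Rightarrow> ('g \<Rightarrow> 'v \<Rightarrow> 'v) \<Rightarrow> ('g \<Rightarrow> 'v) \<Rightarrow> bool"
  where "relative_differential_operator scaleg bracket scalev \<rho> d \<longleftrightarrow>
    Vector_Spaces.linear scaleg scalev d \<and>
    (\<forall>x y. d (bracket x y) = \<rho> x (d y) - \<rho> y (d x))"

text \<open>
  The index set $\mathbb{Z}_3$ is the type \<open>3\<close> of integers modulo 3; the index usually
  written 3 is its element 0.
\<close>

definition hyper_operator :: "(3 \<Rightarrow> 'g \<Rightarrow> 'v) \<Rightarrow> 3 \<Rightarrow> 'g \<Rightarrow> 'g"
  where "hyper_operator d i = inv (d (i - 1)) \<circ> d (i + 1)"

definition hyper_relative_differential_operator ::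
  "('k::field \<Rightarrow> 'g::ab_group_add \<Rightarrow> 'g) \<Rightarrow> ('g \<Rightarrow> 'g \<Rightarrow> 'g) \<Rightarrow>
   ('k \<Rightarrow> 'v::ab_group_add \<Rightarrow> 'v) \<Rightarrow> ('g \<Rightarrow> 'v \<Rightarrow> 'v) \<Rightarrow> (3 \<Rightarrow> int) \<Rightarrow> (3 \<Rightarrow> 'g \<Rightarrow> 'v) \<Rightarrow> bool"
  where "hyper_relative_differential_operator scaleg bracket scalev \<rho> \<epsilon> d \<longleftrightarrow>
    (\<forall>i. relative_differential_operator scaleg bracket scalev \<rho> (d i) \<and> bij (d i)) \<and>
    (\<forall>i. \<epsilon> i \<in> {1, -1} \<and>
         hyper_operator d i \<circ> hyper_operator d i = (\<lambda>x. scaleg (of_int (\<epsilon> i)) x))"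

definition nijenhuis_operator ::
  "('k::field \<Rightarrow> 'g::ab_group_add \<Rightarrow> 'g) \<Rightarrow> ('g \<Rightarrow> 'g \<Rightarrow> 'g) \<Rightarrow> ('g \<Rightarrow> 'g) \<Rightarrow> bool"
  where "nijenhuis_operator scale bracket N \<longleftrightarrow>
    Vector_Spaces.linear scale scale N \<and>
    (\<forall>x y. bracket (N x) (N y) = N (bracket (N x) y + bracket x (N y) - N (bracket x y)))"

definition complex_structure ::
  "('k::field \<Rightarrow> 'g::ab_group_add \<Rightarrow> 'g) \<Rightarrow> ('g \<Rightarrow> 'g \<Rightarrow> 'g) \<Rightarrow> ('g \<Rightarrow> 'g) \<Rightarrow> bool"
  where "complex_structure scale bracket N \<longleftrightarrow>
    nijenhuis_operator scale bracket N \<and> N \<circ> N = (\<lambda>x. - x)"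

definition para_complex_structure ::
  "('k::field \<Rightarrow> 'g::ab_group_add \<Rightarrow> 'g) \<Rightarrow> ('g \<Rightarrow> 'g \<Rightarrow> 'g) \<Rightarrow> ('g \<Rightarrow> 'g) \<Rightarrow> bool"
  where "para_complex_structure scale bracket N \<longleftrightarrow>
    nijenhuis_operator scale bracket N \<and> N \<circ> N = id"

end

theory Submission
  imports Defs
begin

text \<open>
  Fix \<open>i\<close> and write \<open>a\<close>, \<open>b\<close> for the operators \<open>d\<close> at \<open>i - 1\<close>, \<open>i + 1\<close>, and \<open>N = a\<inverse> \<circ> b\<close>.
  The Nijenhuis identity for \<open>N\<close> may be checked after applying the injective map \<open>a\<close>, which turns an
  outer \<open>N\<close> into \<open>b\<close>; each bracket is then expanded by the differential rule of \<open>a\<close> or \<open>b\<close>.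
  Since \<open>a \<circ> N = b\<close> and \<open>N\<^sup>2 = \<epsilon>\<close>, also \<open>b \<circ> N = \<epsilon> a\<close>, so only terms in \<open>a\<close> and \<open>b\<close> survive:
  \<open>b[N x, y] + b[x, N y]\<close> equals \<open>\<rho>(N x)(b y) - \<rho>(N y)(b x)\<close>, which is \<open>a[N x, N y]\<close>,
  plus \<open>\<epsilon> (\<rho>(x)(a y) - \<rho>(y)(a x))\<close>, which is \<open>\<epsilon> a[x, y] = b(N[x, y])\<close>; this last term is
  exactly what the identity subtracts.
\<close>

lemma linear_inv_comp_linear:
  assumes a: "Vector_Spaces.linear s t a" and "bij a" and b: "Vector_Spaces.linear s t b"
  shows "Vector_Spaces.linear s s (inv a \<circ> b)"
proof -
  have a_inv: "a (inv a v) = v" for v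
    using \<open>bij a\<close> by (simp add: bij_is_surj surj_f_inv_f)
  have "Vector_Spaces.linear t s (inv a)"
  proof -
    interpret a: Vector_Spaces.linear s t a by (fact a)
    have inv_add: "inv a (v + w) = inv a v + inv a w" for v w
      by (rule inv_f_eq[OF bij_is_inj[OF \<open>bij a\<close>]]) (simp add: a.add a_inv)
    have inv_scale: "inv a (t r v) = s r (inv a v)" for r v
      by (rule inv_f_eq[OF bij_is_inj[OF \<open>bij a\<close>]]) (simp add: a.scale a_inv)
    show ?thesis
      using inv_add inv_scale by unfold_locales
  qed
  with b show ?thesis
    by (rule Vector_Spaces.linear_compose)
qed

text \<open>
  If \<open>N = a\<inverse> \<circ> b\<close> squares to a scalar \<open>e\<close>, the roles of \<open>a\<close> and \<open>b\<close> are exchanged up to \<open>e\<close> by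
  composing with \<open>N\<close>. This makes the differential rules of \<open>a\<close> and \<open>b\<close> combine into the Nijenhuis
  identity.
\<close>

lemma nijenhuis_operator_quotient:
  assumes "lie_representation scaleg bracket scalev \<rho>"
    and a: "relative_differential_operator scaleg bracket scalev \<rho> a" and "bij a"
    and b: "relative_differential_operator scaleg bracket scalev \<rho> b"
    and square: "(inv a \<circ> b) \<circ> (inv a \<circ> b) = scaleg e"
  shows "nijenhuis_operator scaleg bracket (inv a \<circ> b)"
proof -
  interpret lie_representation scaleg bracket scalev \<rho> by fact
  interpret a: Vector_Spaces.linear scaleg scalev a
    using a by (simp add: relative_differential_operator_def)
  interpret b: Vector_Spaces.linear scaleg scalev b
    using b by (simp add: relative_differential_operator_def)
  interpret rho: Vector_Spaces.linear scalev scalev "\<rho> x" for x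
    by (rule rho_endomorphism)
  have a_bracket: "a (bracket x y) = \<rho> x (a y) - \<rho> y (a x)" for x y
    using a by (simp add: relative_differential_operator_def)
  have b_bracket: "b (bracket x y) = \<rho> x (b y) - \<rho> y (b x)" for x y
    using b by (simp add: relative_differential_operator_def)
  define N where "N = inv a \<circ> b"
  have aN: "a (N x) = b x" for x
    using \<open>bij a\<close> by (simp add: N_def bij_is_surj surj_f_inv_f)
  have bN: "b (N x) = scalev e (a x)" for x
    using square aN[of "N x"] by (simp add: N_def fun_eq_iff a.scale)
  have "bracket (N x) (N y) = N (bracket (N x) y + bracket x (N y) - N (bracket x y))" for x y
  proof (rule injD[OF bij_is_inj[OF \<open>bij a\<close>]])
    show "a (bracket (N x) (N y))
        = a (N (bracket (N x) y + bracket x (N y) - N (bracket x y)))"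
      by (simp add: aN bN a_bracket b_bracket b.add b.diff rho.scale V.scale_right_diff_distrib)
  qed
  moreover have "Vector_Spaces.linear scaleg scaleg N"
    unfolding N_def
    by (rule linear_inv_comp_linear[OF a.linear_axioms \<open>bij a\<close> b.linear_axioms])
  ultimately show ?thesis
    by (simp add: nijenhuis_operator_def N_def)
qed

theorem proposition2p8:
  fixes scaleg :: "'k::field \<Rightarrow> 'g::ab_group_add \<Rightarrow> 'g"
    and bracket :: "'g \<Rightarrow> 'g \<Rightarrow> 'g"
    and scalev :: "'k \<Rightarrow> 'v::ab_group_add \<Rightarrow> 'v"
    and \<rho> :: "'g \<Rightarrow> 'v \<Rightarrow> 'v"
    and \<epsilon> :: "3 \<Rightarrow> int"
    and d :: "3 \<Rightarrow> 'g \<Rightarrow> 'v"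
  assumes "lie_representation scaleg bracket scalev \<rho>"
    and "hyper_relative_differential_operator scaleg bracket scalev \<rho> \<epsilon> d"
  shows "\<forall>i. nijenhuis_operator scaleg bracket (hyper_operator d i) \<and>
      (\<epsilon> i = -1 \<longrightarrow> complex_structure scaleg bracket (hyper_operator d i)) \<and>
      (\<epsilon> i = 1 \<longrightarrow> para_complex_structure scaleg bracket (hyper_operator d i))"
proof
  fix i
  interpret lie_representation scaleg bracket scalev \<rho> by (fact assms(1))
  have d: "relative_differential_operator scaleg bracket scalev \<rho> (d j)" "bij (d j)" for j
    using assms(2) by (simp_all add: hyper_relative_differential_operator_def)
  have square: "hyper_operator d i \<circ> hyper_operator d i = scaleg (of_int (\<epsilon> i))"
    using assms(2) by (simp add: hyper_relative_differential_operator_def)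
  have nijenhuis: "nijenhuis_operator scaleg bracket (hyper_operator d i)"
    using nijenhuis_operator_quotient[OF assms(1) d d(1) square[unfolded hyper_operator_def]]
    by (simp add: hyper_operator_def)
  with square show "nijenhuis_operator scaleg bracket (hyper_operator d i) \<and>
      (\<epsilon> i = -1 \<longrightarrow> complex_structure scaleg bracket (hyper_operator d i)) \<and>
      (\<epsilon> i = 1 \<longrightarrow> para_complex_structure scaleg bracket (hyper_operator d i))"
    by (simp add: complex_structure_def para_complex_structure_def fun_eq_iff)
qed

end
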